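(* Let $\sigma>0$ and consider the scalar scale-mixture model $\lambda\sim\Pi_\lambda$ with $\lambda>0$, $\theta\mid\lambda\sim N(0,\lambda^2)$, and $Y\mid\theta,\lambda\sim N(\theta,\sigma^2/n)$ (so $\lambda\to\theta\to Y$ is a Markov chain). Suppose that $\Pr(\lambda\ge t)\le Ct^{-\alpha}$ for all $t\ge t_0$, with $\alpha>0$, $t_0\ge1$ and $C>0$. Then, for every $n\ge1$, \[ I(\theta;Y)<\infty . \] Consequently, both terms on the right-hand side of the decomposition $I(\theta;Y)=I(\lambda;Y)+I(\theta;Y\mid\lambda)$ are finite.
   Context: $I(U;V)=\mathrm{KL}(P_{U,V}\,\|\,P_U\otimes P_V)$ is mutual information (natural logarithm), and $I(\theta;Y\mid\lambda)$ is the conditional mutual information, i.e. the average over $\lambda\sim\Pi_\lambda$ of the mutual information between $\theta$ and $Y$ under their conditional joint law given $\lambda$. *)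

theory Defs
  imports "HOL-Probability.Probability"
begin

text \<open>
  The library's \<^const>\<open>KL_divergence\<close> is a Bochner integral, hence real-valued, and it is 0 by
  default when the log-density is not integrable. Finiteness is therefore expressed through an
  extended value of \<open>KL(P || Q)\<close> (note the argument order: \<open>KL_divergence b Q P\<close> is
  \<open>KL(P || Q)\<close>). For probability measures with \<open>P\<close> absolutely continuous with respect to \<open>Q\<close>
  the negative part of the log-density is always \<open>P\<close>-integrable, so that failure of integrability
  means \<open>KL(P || Q) = \<infinity>\<close>; and \<open>KL(P || Q) \<ge> 0\<close>, so that nothing is truncated by \<^const>\<open>ennreal\<close>.
\<close>

definition KL :: "'a measure \<Rightarrow> 'a measure \<Rightarrow> ennreal" where
  "KL P Q =
    (if absolutely_continuous Q P \<and> integrable P (entropy_density (exp 1) Q P)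
     then ennreal (KL_divergence (exp 1) Q P) else \<infinity>)"

definition mutual_info ::
  "'a measure \<Rightarrow> 'b measure \<Rightarrow> 'c measure \<Rightarrow> ('a \<Rightarrow> 'b) \<Rightarrow> ('a \<Rightarrow> 'c) \<Rightarrow> ennreal" where
  "mutual_info M S T U V =
    KL (distr M (S \<Otimes>\<^sub>M T) (\<lambda>\<omega>. (U \<omega>, V \<omega>))) (distr M S U \<Otimes>\<^sub>M distr M T V)"

text \<open>
  \<open>K\<close> is a regular conditional law of \<open>W\<close> given \<open>Z\<close>. The kernel is only required to be
  sub-stochastic, so that it may be degenerate at values that \<open>Z\<close> almost surely does not take;
  the integral identity with \<open>A = space S\<close>, \<open>B = space T\<close> forces \<open>K z\<close> to be a probability
  measure for almost all \<open>z\<close> when \<open>M\<close> is a probability space.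
\<close>

definition has_conditional_law ::
  "'a measure \<Rightarrow> 'b measure \<Rightarrow> 'c measure \<Rightarrow> ('a \<Rightarrow> 'b) \<Rightarrow> ('a \<Rightarrow> 'c) \<Rightarrow> ('b \<Rightarrow> 'c measure) \<Rightarrow> bool"
  where
  "has_conditional_law M S T Z W K \<longleftrightarrow>
    Z \<in> M \<rightarrow>\<^sub>M S \<and> W \<in> M \<rightarrow>\<^sub>M T \<and> K \<in> S \<rightarrow>\<^sub>M subprob_algebra T \<and>
    (\<forall>A\<in>sets S. \<forall>B\<in>sets T.
      emeasure M {\<omega> \<in> space M. Z \<omega> \<in> A \<and> W \<omega> \<in> B} = (\<integral>\<^sup>+ z\<in>A. emeasure (K z) B \<partial>distr M S Z))"

text \<open>
  \<open>I(X; Y | Z)\<close>. The library's \<open>conditional_mutual_information\<close> is not used, since it is the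
  difference \<open>I(X; (Y, Z)) - I(X; Z)\<close> rather than an average over the conditioning variable.
  For real-valued \<open>X\<close>, \<open>Y\<close>, \<open>Z\<close> a regular conditional law exists and is unique up to a null set
  of \<open>z\<close>, so the value does not depend on the version that is chosen.
\<close>

definition cond_mutual_info ::
  "'a measure \<Rightarrow> 'b measure \<Rightarrow> 'c measure \<Rightarrow> 'd measure \<Rightarrow>
   ('a \<Rightarrow> 'b) \<Rightarrow> ('a \<Rightarrow> 'c) \<Rightarrow> ('a \<Rightarrow> 'd) \<Rightarrow> ennreal" where
  "cond_mutual_info M S T R X Y Z =
    (let K = (SOME K. has_conditional_law M R (S \<Otimes>\<^sub>M T) Z (\<lambda>\<omega>. (X \<omega>, Y \<omega>)) K)
     in \<integral>\<^sup>+ z. mutual_info (K z) S T fst snd \<partial>distr M R Z)"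

text \<open>The second argument is the variance, whereas \<^const>\<open>normal_density\<close> takes the standard deviation.\<close>

definition normal_law :: "real \<Rightarrow> real \<Rightarrow> real measure" where
  "normal_law m v = density lborel (normal_density m (sqrt v))"

definition scale_mixture_model ::
  "'a measure \<Rightarrow> real \<Rightarrow> nat \<Rightarrow> ('a \<Rightarrow> real) \<Rightarrow> ('a \<Rightarrow> real) \<Rightarrow> ('a \<Rightarrow> real) \<Rightarrow> bool" where
  "scale_mixture_model M \<sigma> n \<Lambda> \<Theta> Y \<longleftrightarrow>
    prob_space M \<and> \<Lambda> \<in> borel_measurable M \<and> (AE \<omega> in M. \<Lambda> \<omega> > 0) \<and>
    has_conditional_law M borel borel \<Lambda> \<Theta> (\<lambda>l. normal_law 0 (l\<^sup>2)) \<and>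
    has_conditional_law M (borel \<Otimes>\<^sub>M borel) borel (\<lambda>\<omega>. (\<Lambda> \<omega>, \<Theta> \<omega>)) Y
      (\<lambda>(l, t). normal_law t (\<sigma>\<^sup>2 / real n))"

end

theory Submission
  imports Defs
begin

text \<open>
  Put \<open>v = \<sigma>\<^sup>2 / n\<close>, let \<open>p\<close> be the density of \<open>Y\<close> and \<open>q\<^sub>l\<close> that of \<open>N(0, l\<^sup>2 + v)\<close>, the law of
  \<open>Y\<close> given \<open>\<lambda> = l\<close>. Then \<open>I(\<theta>; Y)\<close>, \<open>I(\<lambda>; Y)\<close> and \<open>I(\<theta>; Y | \<lambda>)\<close> are the expectations of
  \<open>ln \<phi>\<^sub>\<theta>(Y) - ln p(Y)\<close>, \<open>ln q\<^sub>\<lambda>(Y) - ln p(Y)\<close> and \<open>ln \<phi>\<^sub>\<theta>(Y) - ln q\<^sub>\<lambda>(Y)\<close>, where \<open>\<phi>\<^sub>t\<close> is the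
  density of \<open>N(t, v)\<close>, so that everything follows from the integrability of the three logarithms.
  The Gaussian ones reduce to \<open>E ln (\<lambda>\<^sup>2 + v) < \<infinity>\<close>, a consequence of the tail bound. Since \<open>p\<close> is
  bounded, only \<open>- ln p(Y)\<close> has to be bounded from above, and with \<open>r(y) = 1 / (1 + y\<^sup>2)\<close>
  \[ - \ln p(Y) \le r(Y) / p(Y) + \ln (1 + Y^2), \qquad
     \ln (1 + Y^2) \le \ln (1 + \lambda^2 + v) + Y^2 / (\lambda^2 + v), \]
  where \<open>r(Y) / p(Y)\<close> has expectation \<open>\<integral> r = \<pi>\<close> and \<open>Y\<^sup>2 / (\<lambda>\<^sup>2 + v)\<close> has expectation \<open>1\<close>.
\<close>

subsection \<open>Conditional laws\<close>

text \<open>The definition of a conditional law tests only rectangles. Rectangles form an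
  intersection-stable generator of the product sigma-algebra, so the identity determines the whole
  joint law and passes to every nonnegative measurable integrand.\<close>

lemma nn_integral_conditional_law:
  assumes "prob_space M" and K: "has_conditional_law M S T Z W K"
    and f: "f \<in> borel_measurable (S \<Otimes>\<^sub>M T)"
  shows "(\<integral>\<^sup>+ \<omega>. f (Z \<omega>, W \<omega>) \<partial>M) = (\<integral>\<^sup>+ \<omega>. \<integral>\<^sup>+ w. f (Z \<omega>, w) \<partial>K (Z \<omega>) \<partial>M)"
proof -
  interpret prob_space M by fact
  have Z[measurable]: "Z \<in> M \<rightarrow>\<^sub>M S" and W[measurable]: "W \<in> M \<rightarrow>\<^sub>M T"
    and Km[measurable]: "K \<in> S \<rightarrow>\<^sub>M subprob_algebra T"
    using K by (auto simp: has_conditional_law_def)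
  \<comment> \<open>\<open>G z\<close> is the product of the point mass at \<open>z\<close> with
    \<open>K z\<close>, so binding it to the law of \<open>Z\<close> gives the candidate for the
    joint law of \<open>(Z, W)\<close>.\<close>
  define G where "G z = distr (K z) (S \<Otimes>\<^sub>M T) (Pair z)" for z
  have G[measurable]: "G \<in> S \<rightarrow>\<^sub>M subprob_algebra (S \<Otimes>\<^sub>M T)"
    unfolding G_def by (rule measurable_distr2[OF _ Km]) simp
  have Pz: "Pair z \<in> K z \<rightarrow>\<^sub>M S \<Otimes>\<^sub>M T" if "z \<in> space S" for z
    using that sets_kernel[OF Km that] by (simp cong: measurable_cong_sets)
  interpret Z: prob_space "distr M S Z" by (rule prob_space_distr) simp
  have "distr M (S \<Otimes>\<^sub>M T) (\<lambda>\<omega>. (Z \<omega>, W \<omega>)) = distr M S Z \<bind> G"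
  proof (rule measure_eqI_generator_eq[OF Int_stable_pair_measure_generator[of S T]
        pair_measure_closed, where A = "\<lambda>_. space S \<times> space T"])
    fix X assume "X \<in> {a \<times> b |a b. a \<in> sets S \<and> b \<in> sets T}"
    then obtain A B where X: "X = A \<times> B" and [measurable]: "A \<in> sets S" "B \<in> sets T" by auto
    have "emeasure (distr M S Z \<bind> G) X = (\<integral>\<^sup>+ z. emeasure (G z) X \<partial>distr M S Z)"
      unfolding X using Z.not_empty by (intro emeasure_bind[where N="S \<Otimes>\<^sub>M T"]) auto
    also have "\<dots> = (\<integral>\<^sup>+ z\<in>A. emeasure (K z) B \<partial>distr M S Z)"
    proof (rule nn_integral_cong)
      fix z assume "z \<in> space (distr M S Z)"
      then have z: "z \<in> space S" by simp
      have B: "B \<subseteq> space T" using \<open>B \<in> sets T\<close> by (rule sets.sets_into_space)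
      have "emeasure (G z) X = emeasure (K z) (Pair z -` X \<inter> space (K z))"
        unfolding G_def X using Pz[OF z] by (intro emeasure_distr) auto
      also have "space (K z) = space T"
        using sets_kernel[OF Km z] by (rule sets_eq_imp_space_eq)
      also have "emeasure (K z) (Pair z -` X \<inter> space T) = emeasure (K z) B * indicator A z"
        using B by (auto simp: X indicator_def Int_absorb2 intro!: arg_cong2[of _ _ _ _ emeasure])
      finally show "emeasure (G z) X = emeasure (K z) B * indicator A z" .
    qed
    also have "\<dots> = emeasure M {\<omega> \<in> space M. Z \<omega> \<in> A \<and> W \<omega> \<in> B}"
      using K by (simp add: has_conditional_law_def)
    also have "\<dots> = emeasure (distr M (S \<Otimes>\<^sub>M T) (\<lambda>\<omega>. (Z \<omega>, W \<omega>))) X"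
      unfolding X by (subst emeasure_distr) (auto intro!: arg_cong2[of _ _ _ _ emeasure])
    finally show "emeasure (distr M (S \<Otimes>\<^sub>M T) (\<lambda>\<omega>. (Z \<omega>, W \<omega>))) X
      = emeasure (distr M S Z \<bind> G) X" ..
  next
    show "sets (distr M S Z \<bind> G) = sigma_sets (space S \<times> space T) {a \<times> b |a b. a \<in> sets S \<and> b \<in> sets T}"
      using Z.not_empty sets_bind[of "distr M S Z" G "S \<Otimes>\<^sub>M T"] sets_kernel[OF G]
      by (simp add: sets_pair_measure)
    show "emeasure (distr M (S \<Otimes>\<^sub>M T) (\<lambda>\<omega>. (Z \<omega>, W \<omega>))) (space S \<times> space T) \<noteq> \<infinity>"
      by (subst emeasure_distr) auto
  qed (auto simp: sets_pair_measure)
  moreover have "(\<integral>\<^sup>+ \<omega>. f (Z \<omega>, W \<omega>) \<partial>M) = (\<integral>\<^sup>+ x. f x \<partial>distr M (S \<Otimes>\<^sub>M T) (\<lambda>\<omega>. (Z \<omega>, W \<omega>)))"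
    using f by (intro nn_integral_distr[symmetric]) auto
  ultimately have "(\<integral>\<^sup>+ \<omega>. f (Z \<omega>, W \<omega>) \<partial>M) = (\<integral>\<^sup>+ x. f x \<partial>(distr M S Z \<bind> G))"
    by simp
  also have "\<dots> = (\<integral>\<^sup>+ z. \<integral>\<^sup>+ x. f x \<partial>G z \<partial>distr M S Z)"
    using f by (intro nn_integral_bind) auto
  also have "\<dots> = (\<integral>\<^sup>+ z. \<integral>\<^sup>+ w. f (z, w) \<partial>K z \<partial>distr M S Z)"
    using f Pz by (intro nn_integral_cong) (auto simp: G_def nn_integral_distr)
  also have "\<dots> = (\<integral>\<^sup>+ \<omega>. \<integral>\<^sup>+ w. f (Z \<omega>, w) \<partial>K (Z \<omega>) \<partial>M)"
  proof (rule nn_integral_distr)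
    \<comment> \<open>Here the measure and the integrand both vary with \<open>z\<close>. Rewriting
      through \<open>G\<close> leaves a fixed integrand against a measurable kernel.\<close>
    have "(\<lambda>z. \<integral>\<^sup>+ x. f x \<partial>G z) \<in> borel_measurable S"
      using f by (intro measurable_compose[OF G nn_integral_measurable_subprob_algebra]) auto
    then show "(\<lambda>z. \<integral>\<^sup>+ w. f (z, w) \<partial>K z) \<in> borel_measurable (distr M S Z)"
      using f Pz by (simp add: G_def nn_integral_distr cong: measurable_cong)
  qed simp
  finally show ?thesis .
qed

text \<open>Finite intersections of a countable basis form such a family. Countability lets
  almost-sure equalities hold simultaneously for all members; stability under intersection lets them
  determine a measure.\<close>

lemma countable_Int_stable_borel_generator:
  obtains E :: "'a::second_countable_topology set set"
  where "countable E" "Int_stable E" "UNIV \<in> E" "sets borel = sigma_sets UNIV E"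
proof -
  obtain B :: "'a set set" where B: "countable B" "topological_basis B"
    using ex_countable_basis by blast
  define E where "E = Inter ` {F. finite F \<and> F \<subseteq> B}"
  have 1: "countable E"
    unfolding E_def using countable_Collect_finite_subset[OF B(1)] by simp
  have 2: "Int_stable E"
  proof (rule Int_stableI)
    fix a b assume "a \<in> E" "b \<in> E"
    then obtain F G where "finite F" "F \<subseteq> B" "a = \<Inter>F" "finite G" "G \<subseteq> B" "b = \<Inter>G"
      by (auto simp: E_def)
    then have "a \<inter> b = \<Inter>(F \<union> G)" "finite (F \<union> G)" "F \<union> G \<subseteq> B" by auto
    then show "a \<inter> b \<in> E" by (auto simp: E_def)
  qed
  \<comment> \<open>The empty family has intersection \<open>UNIV\<close>.\<close>
  have 3: "UNIV \<in> E" unfolding E_def by (rule image_eqI[of _ _ "{}"]) auto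
  have "open X" if "X \<in> E" for X
    using that topological_basis_open[OF B(2)] by (auto simp: E_def intro!: open_Inter)
  then have "sigma_sets UNIV E \<subseteq> sets borel"
    by (intro sets.sigma_sets_subset[of _ borel, simplified]) auto
  moreover have "B \<subseteq> E"
  proof
    fix X assume "X \<in> B" then show "X \<in> E"
      unfolding E_def by (intro image_eqI[of _ _ "{X}"]) auto
  qed
  then have "sets borel \<subseteq> sigma_sets UNIV E"
    unfolding borel_eq_countable_basis[OF B] by (simp add: sigma_sets_mono')
  ultimately have "sets borel = sigma_sets UNIV E" by simp
  with 1 2 3 that show ?thesis by blast
qed

text \<open>For a fixed event the two kernels are densities of the same measure with respect to the
  law of \<open>Z\<close>, hence agree almost everywhere. A countable generator merges the
  exceptional null sets into one. This makes the arbitrary choice of kernel in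
  \<open>cond_mutual_info\<close> computable.\<close>

lemma has_conditional_law_unique:
  fixes W :: "'a \<Rightarrow> 'c::second_countable_topology"
  assumes "prob_space M" and K: "has_conditional_law M S borel Z W K"
    and K': "has_conditional_law M S borel Z W K'"
  shows "AE z in distr M S Z. K z = K' z"
proof -
  interpret prob_space M by fact
  have [measurable]: "Z \<in> M \<rightarrow>\<^sub>M S" "K \<in> S \<rightarrow>\<^sub>M subprob_algebra borel" "K' \<in> S \<rightarrow>\<^sub>M subprob_algebra borel"
    using K K' by (auto simp: has_conditional_law_def)
  interpret Z: prob_space "distr M S Z" by (rule prob_space_distr) simp
  obtain E :: "'c set set" where E: "countable E" "Int_stable E" "UNIV \<in> E"
    "sets borel = sigma_sets UNIV E"
    by (rule countable_Int_stable_borel_generator)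
  have "AE z in distr M S Z. \<forall>B\<in>E. emeasure (K z) B = emeasure (K' z) B"
    unfolding AE_ball_countable[OF E(1)]
  proof
    fix B assume "B \<in> E"
    then have B[measurable]: "B \<in> sets borel" using E(4) by auto
    show "AE z in distr M S Z. emeasure (K z) B = emeasure (K' z) B"
    proof (rule Z.density_unique2)
      fix A assume "A \<in> sets (distr M S Z)"
      then show "(\<integral>\<^sup>+ z\<in>A. emeasure (K z) B \<partial>distr M S Z) = (\<integral>\<^sup>+ z\<in>A. emeasure (K' z) B \<partial>distr M S Z)"
        using K K' B unfolding has_conditional_law_def by simp
    qed simp_all
  qed
  then have "AE z in distr M S Z. z \<in> space S \<and> (\<forall>B\<in>E. emeasure (K z) B = emeasure (K' z) B)"
    using AE_space[of "distr M S Z"] by (auto elim: AE_mp)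
  then show ?thesis
  proof (rule AE_mp[OF _ AE_I2], intro impI)
    fix z assume z: "z \<in> space S \<and> (\<forall>B\<in>E. emeasure (K z) B = emeasure (K' z) B)"
    have Kz: "sets (K z) = sets borel" "sets (K' z) = sets borel" "subprob_space (K z)"
      using z by (auto intro!: sets_kernel[of K S borel] sets_kernel[of K' S borel] subprob_space_kernel[of K S borel])
    show "K z = K' z"
    proof (rule measure_eqI_generator_eq[OF E(2), of UNIV _ _ "\<lambda>_. UNIV"])
      show "emeasure (K z) UNIV \<noteq> \<infinity>"
        using subprob_space.subprob_emeasure_le_1[OF Kz(3)] by (metis ennreal_one_neq_top infinity_ennreal_def top_unique)
    qed (use z Kz E in auto)
  qed
qed

subsection \<open>Mutual information of a channel with a density\<close>

text \<open>The Radon-Nikodym derivative inside \<open>entropy_density\<close> is fixed only up to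
  \<open>Q\<close>-null sets. These are null for \<open>density Q g\<close> too, so \<open>g\<close>
  may replace it, and the base \<open>exp 1\<close> turns \<open>log\<close> into
  \<open>ln\<close>.\<close>

lemma KL_density_eq:
  fixes g :: "'a \<Rightarrow> real"
  assumes "sigma_finite_measure Q" and g[measurable]: "g \<in> borel_measurable Q" and nn: "\<And>x. 0 \<le> g x"
    and int: "integrable (density Q g) (\<lambda>x. ln (g x))"
  shows "KL (density Q g) Q = ennreal (\<integral>x. ln (g x) \<partial>density Q g)"
proof -
  interpret sigma_finite_measure Q by fact
  have "AE x in Q. ennreal (g x) = RN_deriv Q (density Q g) x"
    by (rule RN_deriv_unique) auto
  then have "AE x in Q. entropy_density (exp 1) Q (density Q g) x = ln (g x)"
  proof eventually_elim
    case (elim x)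
    then show ?case using nn[of x] by (simp add: entropy_density_def log_def elim[symmetric])
  qed
  then have ae: "AE x in density Q g. entropy_density (exp 1) Q (density Q g) x = ln (g x)"
    by (subst AE_density) auto
  have [measurable]: "entropy_density (exp 1) Q (density Q g) \<in> borel_measurable (density Q g)"
    by simp
  have "integrable (density Q g) (entropy_density (exp 1) Q (density Q g))"
    using int by (subst integrable_cong_AE[OF _ _ ae]) auto
  moreover have "KL_divergence (exp 1) Q (density Q g) = (\<integral>x. ln (g x) \<partial>density Q g)"
    unfolding KL_divergence_def by (rule integral_cong_AE[OF _ _ ae]) auto
  ultimately show ?thesis
    by (simp add: KL_def absolutely_continuousI_density)
qed

text \<open>Given the input \<open>X\<close>, the output \<open>Y\<close> has Lebesgue density
  \<open>d (X, _)\<close>. This is encoded as a disintegration identity under \<open>M\<close>, so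
  values of \<open>d\<close> at inputs that almost surely do not occur are irrelevant, and a
  constant input is allowed.\<close>

locale channel = prob_space M
  for M :: "'a measure" and S :: "'b measure" and X :: "'a \<Rightarrow> 'b" and Y :: "'a \<Rightarrow> real"
    and d :: "'b \<times> real \<Rightarrow> real" +
  assumes X[measurable]: "X \<in> M \<rightarrow>\<^sub>M S" and Y[measurable]: "Y \<in> borel_measurable M"
    and d[measurable]: "d \<in> borel_measurable (S \<Otimes>\<^sub>M borel)" and d_nonneg: "\<And>z. 0 \<le> d z"
    and nn_integral_channel: "\<And>f. f \<in> borel_measurable (S \<Otimes>\<^sub>M borel) \<Longrightarrow>
      (\<integral>\<^sup>+ \<omega>. f (X \<omega>, Y \<omega>) \<partial>M) = (\<integral>\<^sup>+ \<omega>. \<integral>\<^sup>+ y. ennreal (d (X \<omega>, y)) * f (X \<omega>, y) \<partial>lborel \<partial>M)"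
begin

lemma distr_pair_eq_density:
  "distr M (S \<Otimes>\<^sub>M borel) (\<lambda>\<omega>. (X \<omega>, Y \<omega>)) = density (distr M S X \<Otimes>\<^sub>M lborel) d"
proof (rule measure_eqI)
  fix A assume "A \<in> sets (distr M (S \<Otimes>\<^sub>M borel) (\<lambda>\<omega>. (X \<omega>, Y \<omega>)))"
  then have [measurable]: "A \<in> sets (S \<Otimes>\<^sub>M borel)" by simp
  have "emeasure (distr M (S \<Otimes>\<^sub>M borel) (\<lambda>\<omega>. (X \<omega>, Y \<omega>))) A = (\<integral>\<^sup>+ \<omega>. indicator A (X \<omega>, Y \<omega>) \<partial>M)"
    by (subst nn_integral_indicator[symmetric], simp, subst nn_integral_distr) auto
  also have "\<dots> = (\<integral>\<^sup>+ \<omega>. \<integral>\<^sup>+ y. ennreal (d (X \<omega>, y)) * indicator A (X \<omega>, y) \<partial>lborel \<partial>M)"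
    by (rule nn_integral_channel) simp
  also have "\<dots> = (\<integral>\<^sup>+ x. \<integral>\<^sup>+ y. ennreal (d (x, y)) * indicator A (x, y) \<partial>lborel \<partial>distr M S X)"
    by (subst nn_integral_distr) auto
  also have "\<dots> = (\<integral>\<^sup>+ z. ennreal (d z) * indicator A z \<partial>(distr M S X \<Otimes>\<^sub>M lborel))"
    by (subst lborel.nn_integral_fst) auto
  also have "\<dots> = emeasure (density (distr M S X \<Otimes>\<^sub>M lborel) d) A"
    by (subst emeasure_density) auto
  finally show "emeasure (distr M (S \<Otimes>\<^sub>M borel) (\<lambda>\<omega>. (X \<omega>, Y \<omega>))) A
    = emeasure (density (distr M S X \<Otimes>\<^sub>M lborel) d) A" .
qed (simp cong: sets_pair_measure_cong)

text \<open>The joint law and the product of the marginals have densities \<open>d (x, y)\<close>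
  and \<open>p y\<close> with respect to the same measure. As \<open>p\<close> is positive, the
  quotient is the density of the first with respect to the second.\<close>

lemma mutual_info_eq:
  fixes p :: "real \<Rightarrow> real"
  assumes p[measurable]: "p \<in> borel_measurable borel" and p_pos: "\<And>y. 0 < p y"
    and Yp: "distr M borel Y = density lborel p"
    and int: "integrable M (\<lambda>\<omega>. ln (d (X \<omega>, Y \<omega>) / p (Y \<omega>)))"
  shows "mutual_info M S borel X Y = ennreal (\<integral>\<omega>. ln (d (X \<omega>, Y \<omega>) / p (Y \<omega>)) \<partial>M)"
proof -
  let ?R = "distr M S X \<Otimes>\<^sub>M lborel"
  let ?Q = "distr M S X \<Otimes>\<^sub>M distr M borel Y"
  let ?J = "distr M (S \<Otimes>\<^sub>M borel) (\<lambda>\<omega>. (X \<omega>, Y \<omega>))"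
  define r where "r z = d z / p (snd z)" for z
  have r[measurable]: "r \<in> borel_measurable (S \<Otimes>\<^sub>M borel)" unfolding r_def by measurable
  interpret PX: prob_space "distr M S X" by (rule prob_space_distr) simp
  interpret PY: prob_space "distr M borel Y" by (rule prob_space_distr) simp
  interpret P: pair_prob_space "distr M S X" "distr M borel Y" ..
  have "?Q = density ?R (\<lambda>z. ennreal (p (snd z)))"
  proof -
    have "sigma_finite_measure (density lborel (\<lambda>y. ennreal (p y)))"
      unfolding Yp[symmetric] by (rule PY.sigma_finite_measure_axioms)
    from pair_measure_density[OF _ _ lborel.sigma_finite_measure_axioms this, of "\<lambda>_. 1" "distr M S X"]
    show ?thesis
      by (simp add: Yp density_1 split_def)
  qed
  moreover have "density (density ?R (\<lambda>z. ennreal (p (snd z)))) (\<lambda>z. d z / p (snd z)) = density ?R d"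
    using p_pos d_nonneg by (intro density_density_divide) (auto simp: less_imp_le less_imp_neq[symmetric])
  ultimately have J: "?J = density ?Q r"
    unfolding distr_pair_eq_density r_def by simp
  have "integrable ?J (\<lambda>z. ln (r z))"
    using int by (subst integrable_distr_eq) (auto simp: r_def)
  then have "KL ?J ?Q = ennreal (\<integral>z. ln (r z) \<partial>?J)"
    unfolding J using d_nonneg p_pos
    by (intro KL_density_eq) (auto simp: r_def P.sigma_finite_measure_axioms less_imp_le)
  also have "(\<integral>z. ln (r z) \<partial>?J) = (\<integral>\<omega>. ln (d (X \<omega>, Y \<omega>) / p (Y \<omega>)) \<partial>M)"
    by (subst integral_distr) (auto simp: r_def)
  finally show ?thesis by (simp add: mutual_info_def)
qed

text \<open>Gibbs' inequality: \<open>p (Y) / d (X, Y)\<close> has expectation \<open>1\<close>,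
  because \<open>d\<close> cancels and \<open>p\<close> integrates to \<open>1\<close>. The sign
  matters because \<open>ennreal\<close> truncates negative reals, so sums of such values split only
  for nonnegative arguments.\<close>

lemma expectation_ln_ratio_nonneg:
  fixes p :: "real \<Rightarrow> real"
  assumes p[measurable]: "p \<in> borel_measurable borel" and p_pos: "\<And>y. 0 < p y"
    and Yp: "distr M borel Y = density lborel p"
    and d_pos: "\<And>z. 0 < d z"
    and int: "integrable M (\<lambda>\<omega>. ln (d (X \<omega>, Y \<omega>) / p (Y \<omega>)))"
  shows "0 \<le> (\<integral>\<omega>. ln (d (X \<omega>, Y \<omega>) / p (Y \<omega>)) \<partial>M)"
proof -
  interpret PY: prob_space "distr M borel Y" by (rule prob_space_distr) simp
  have p1: "(\<integral>\<^sup>+ y. ennreal (p y) \<partial>lborel) = 1"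
    using PY.emeasure_space_1 unfolding Yp by (simp add: emeasure_density)
  have [simp]: "d z \<noteq> 0" for z
    using d_pos[of z] by simp
  have "(\<integral>\<^sup>+ \<omega>. ennreal (p (Y \<omega>) / d (X \<omega>, Y \<omega>)) \<partial>M) = 
      (\<integral>\<^sup>+ \<omega>. \<integral>\<^sup>+ y. ennreal (d (X \<omega>, y)) * ennreal (p y / d (X \<omega>, y)) \<partial>lborel \<partial>M)"
    using nn_integral_channel[of "\<lambda>z. ennreal (p (snd z) / d z)"] by simp
  also have "\<dots> = 1"
    using p1 by (simp add: ennreal_mult'[symmetric] d_nonneg emeasure_space_1)
  finally have "has_bochner_integral M (\<lambda>\<omega>. p (Y \<omega>) / d (X \<omega>, Y \<omega>)) 1"
    using p_pos d_pos by (intro has_bochner_integral_nn_integral) (auto simp: less_imp_le)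
  then have i: "integrable M (\<lambda>\<omega>. p (Y \<omega>) / d (X \<omega>, Y \<omega>))"
    and e: "(\<integral>\<omega>. p (Y \<omega>) / d (X \<omega>, Y \<omega>) \<partial>M) = 1"
    by (auto simp: has_bochner_integral_iff)
  \<comment> \<open>This is \<open>ln u \<ge> 1 - 1 / u\<close> for \<open>u = d z / p y\<close>,
    that is, \<open>ln w \<le> w - 1\<close> at \<open>w = 1 / u\<close>.\<close>
  have le: "1 - p y / d z \<le> ln (d z / p y)" for y z
    using ln_le_minus_one[of "p y / d z"] p_pos[of y] d_pos[of z] by (simp add: ln_div)
  have "0 = (\<integral>\<omega>. 1 - p (Y \<omega>) / d (X \<omega>, Y \<omega>) \<partial>M)"
    using i e by (simp add: prob_space)
  also have "\<dots> \<le> (\<integral>\<omega>. ln (d (X \<omega>, Y \<omega>) / p (Y \<omega>)) \<partial>M)"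
    using i int le by (intro integral_mono) auto
  finally show ?thesis .
qed

lemma distr_output_eq_density:
  assumes p: "\<And>y. ennreal (p y) = (\<integral>\<^sup>+ \<omega>. ennreal (d (X \<omega>, y)) \<partial>M)"
    and [measurable]: "p \<in> borel_measurable borel"
  shows "distr M borel Y = density lborel p"
proof (rule measure_eqI)
  fix A assume "A \<in> sets (distr M borel Y)"
  then have [measurable]: "A \<in> sets borel" by simp
  interpret pair_sigma_finite M lborel ..
  have "emeasure (distr M borel Y) A = (\<integral>\<^sup>+ \<omega>. indicator A (Y \<omega>) \<partial>M)"
    by (subst nn_integral_indicator[symmetric], simp, subst nn_integral_distr) auto
  also have "\<dots> = (\<integral>\<^sup>+ \<omega>. \<integral>\<^sup>+ y. ennreal (d (X \<omega>, y)) * indicator A y \<partial>lborel \<partial>M)"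
    using nn_integral_channel[of "\<lambda>z. indicator A (snd z)"] by simp
  also have "\<dots> = (\<integral>\<^sup>+ y. \<integral>\<^sup>+ \<omega>. ennreal (d (X \<omega>, y)) * indicator A y \<partial>M \<partial>lborel)"
    by (rule Fubini'[symmetric]) measurable
  also have "\<dots> = emeasure (density lborel p) A"
    by (simp add: emeasure_density p nn_integral_multc)
  finally show "emeasure (distr M borel Y) A = emeasure (density lborel p) A" .
qed simp

end

lemma ln_normal_density:
  assumes "0 < s"
  shows "ln (normal_density m s y) = - ln s - ln (2 * pi) / 2 - ((y - m) / s)\<^sup>2 / 2"
proof -
  have "ln (normal_density m s y) = - ln (sqrt (2 * pi * s\<^sup>2)) - (y - m)\<^sup>2 / (2 * s\<^sup>2)"
    using assms unfolding normal_density_def by (subst ln_mult) (auto simp: ln_div)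
  also have "ln (sqrt (2 * pi * s\<^sup>2)) = ln (2 * pi) / 2 + ln s"
    using assms by (simp add: real_sqrt_mult ln_mult ln_sqrt)
  finally show ?thesis by (simp add: power_divide)
qed

text \<open>Given the input, the standardised residual has second moment \<open>1\<close>, whatever
  the mean and scale are. The quadratic term of the log-density therefore contributes exactly
  \<open>- 1 / 2\<close>, and only the logarithm of the scale needs an integrability
  assumption.\<close>

lemma (in channel) has_bochner_integral_ln_normal_channel:
  assumes d_eq: "\<And>x y. d (x, y) = normal_density (m x) (\<tau> x) y"
    and [measurable]: "m \<in> borel_measurable S" "\<tau> \<in> borel_measurable S"
    and pos: "AE \<omega> in M. 0 < \<tau> (X \<omega>)" and int: "integrable M (\<lambda>\<omega>. ln (\<tau> (X \<omega>)))"
  shows "has_bochner_integral M (\<lambda>\<omega>. ((Y \<omega> - m (X \<omega>)) / \<tau> (X \<omega>))\<^sup>2) 1"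
    and "has_bochner_integral M (\<lambda>\<omega>. ln (d (X \<omega>, Y \<omega>)))
      (- (\<integral>\<omega>. ln (\<tau> (X \<omega>)) \<partial>M) - ln (2 * pi) / 2 - 1 / 2)"
proof -
  have *: "(\<integral>\<^sup>+ y. ennreal (normal_density a s y) * ennreal (((y - a) / s)\<^sup>2) \<partial>lborel) = 1"
    if "0 < s" for a s :: real
  proof -
    \<comment> \<open>The even moment formula with \<open>k = 1\<close> gives the variance
      \<open>s\<^sup>2\<close>; the factor \<open>inverse (s\<^sup>2)\<close> normalises it to
      \<open>1\<close>.\<close>
    have "has_bochner_integral lborel (\<lambda>y. (normal_density a s y * (y - a)^(2 * 1)) * inverse (s\<^sup>2))
        (fact (2 * 1) / ((2 / s\<^sup>2)^1 * fact 1) * inverse (s\<^sup>2))"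
      using that by (intro has_bochner_integral_mult_left normal_moment_even)
    then have "has_bochner_integral lborel (\<lambda>y. normal_density a s y * ((y - a) / s)\<^sup>2) 1"
      using that by (simp add: power_divide fact_numeral divide_inverse[symmetric])
    then show ?thesis
      using that by (simp add: ennreal_mult'[symmetric] has_bochner_integral_iff nn_integral_eq_integral)
  qed
  have "(\<integral>\<^sup>+ \<omega>. ennreal (((Y \<omega> - m (X \<omega>)) / \<tau> (X \<omega>))\<^sup>2) \<partial>M) = 
      (\<integral>\<^sup>+ \<omega>. \<integral>\<^sup>+ y. ennreal (d (X \<omega>, y)) * ennreal (((y - m (X \<omega>)) / \<tau> (X \<omega>))\<^sup>2) \<partial>lborel \<partial>M)"
    using nn_integral_channel[of "\<lambda>z. ennreal (((snd z - m (fst z)) / \<tau> (fst z))\<^sup>2)"] by simp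
  also have "\<dots> = (\<integral>\<^sup>+ \<omega>. 1 \<partial>M)"
    by (rule nn_integral_cong_AE) (use pos * in \<open>auto simp: d_eq\<close>)
  finally show sq: "has_bochner_integral M (\<lambda>\<omega>. ((Y \<omega> - m (X \<omega>)) / \<tau> (X \<omega>))\<^sup>2) 1"
    by (intro has_bochner_integral_nn_integral) (auto simp: emeasure_space_1)
  have [measurable]: "(\<lambda>\<omega>. ln (d (X \<omega>, Y \<omega>))) \<in> borel_measurable M" by measurable
  have "has_bochner_integral M
      (\<lambda>\<omega>. - ln (\<tau> (X \<omega>)) - ln (2 * pi) / 2 - ((Y \<omega> - m (X \<omega>)) / \<tau> (X \<omega>))\<^sup>2 / 2)
      (- (\<integral>\<omega>. ln (\<tau> (X \<omega>)) \<partial>M) - ln (2 * pi) / 2 - 1 / 2)"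
    using int sq by (simp add: has_bochner_integral_iff prob_space)
  then show "has_bochner_integral M (\<lambda>\<omega>. ln (d (X \<omega>, Y \<omega>)))
      (- (\<integral>\<omega>. ln (\<tau> (X \<omega>)) \<partial>M) - ln (2 * pi) / 2 - 1 / 2)"
  proof (rule has_bochner_integral_cong_AE[THEN iffD1, rotated -1])
    show "AE \<omega> in M. - ln (\<tau> (X \<omega>)) - ln (2 * pi) / 2 - ((Y \<omega> - m (X \<omega>)) / \<tau> (X \<omega>))\<^sup>2 / 2 =
        ln (d (X \<omega>, Y \<omega>))"
      using pos by eventually_elim (simp add: d_eq ln_normal_density)
  qed measurable
qed

subsection \<open>The normal scale mixture\<close>

text \<open>The positive part of \<open>ln X\<close> is at most the number of \<open>k \<ge> 0\<close> with \<open>X \<ge> exp k\<close>.\<close>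

lemma (in prob_space) integrable_ln_of_polynomial_tail:
  fixes X :: "'a \<Rightarrow> real"
  assumes X[measurable]: "X \<in> borel_measurable M" and "a > 0" and "\<alpha> > 0"
    and tail: "\<And>t. t \<ge> t\<^sub>0 \<Longrightarrow> prob {\<omega> \<in> space M. X \<omega> \<ge> t} \<le> C * t powr (- \<alpha>)"
    and pos: "AE \<omega> in M. 0 < X \<omega>"
  shows "integrable M (\<lambda>\<omega>. ln (a + (X \<omega>)\<^sup>2))"
proof -
  define E where "E k = {\<omega> \<in> space M. X \<omega> \<ge> exp (real k)}" for k :: nat
  have [measurable]: "E k \<in> sets M" for k unfolding E_def by simp
  \<comment> \<open>Since \<open>exp k \<ge> 1 + k\<close>, the tail bound applies at
    \<open>t = exp k\<close> from \<open>k0\<close> on. There it reads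
    \<open>C * exp (- \<alpha>) ^ k\<close>, a geometric series.\<close>
  obtain k0 :: nat where k0: "t\<^sub>0 \<le> real k0" using real_arch_simple by blast
  have "summable (\<lambda>k. prob (E k))"
  proof (rule summable_comparison_test'[of _ k0])
    show "summable (\<lambda>k. C * exp (- \<alpha>) ^ k)"
      using \<open>\<alpha> > 0\<close> by (intro summable_mult summable_geometric) simp
    fix k assume "k0 \<le> k"
    then have "t\<^sub>0 \<le> exp (real k)"
      using k0 exp_ge_add_one_self[of "real k"] by linarith
    from tail[OF this] show "norm (prob (E k)) \<le> C * exp (- \<alpha>) ^ k"
      by (simp add: E_def powr_def exp_of_nat_mult[symmetric] mult.commute)
  qed
  then have "(\<Sum>k. emeasure M (E k)) < \<infinity>"
    by (simp add: emeasure_eq_measure suminf_ennreal2 less_top[symmetric])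
  then have fin: "(\<integral>\<^sup>+ \<omega>. (\<Sum>k. indicator (E k) \<omega>) \<partial>M) < \<infinity>"
    by (subst nn_integral_suminf) auto
  have le: "ennreal (max 0 (ln (X \<omega>))) \<le> (\<Sum>k. indicator (E k) \<omega>)" if "\<omega> \<in> space M" "0 < X \<omega>" for \<omega>
  proof (cases "X \<omega> \<ge> 1")
    case True
    define m where "m = nat \<lfloor>ln (X \<omega>)\<rfloor>"
    have ln0: "0 \<le> ln (X \<omega>)" using True by simp
    then have m: "real m \<le> ln (X \<omega>)" "ln (X \<omega>) \<le> real (Suc m)"
      unfolding m_def by linarith+
    have "\<omega> \<in> E k" if "k \<le> m" for k
    proof -
      have "real k \<le> ln (X \<omega>)" using that m(1) by linarith
      then have "exp (real k) \<le> X \<omega>" using \<open>0 < X \<omega>\<close> by (simp add: ln_ge_iff)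
      then show ?thesis using \<open>\<omega> \<in> space M\<close> by (simp add: E_def)
    qed
    \<comment> \<open>Counting from \<open>k = 0\<close> gives \<open>m + 1\<close> events, not
      \<open>m\<close>, which is enough to dominate \<open>ln (X \<omega>)\<close> although
      \<open>m\<close> is only its floor.\<close>
    then have "(\<Sum>k<Suc m. indicator (E k) \<omega>) = (\<Sum>k<Suc m. 1::ennreal)"
      by (intro sum.cong) auto
    moreover have "(\<Sum>k<Suc m. indicator (E k) \<omega>) \<le> (\<Sum>k. indicator (E k) \<omega> :: ennreal)"
      by (rule sum_le_suminf) auto
    ultimately have "of_nat (Suc m) \<le> (\<Sum>k. indicator (E k) \<omega> :: ennreal)" by simp
    moreover have "ennreal (max 0 (ln (X \<omega>))) \<le> of_nat (Suc m)"
      using m ln0 by (subst ennreal_of_nat_eq_real_of_nat) (intro ennreal_leI, simp)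
    ultimately show ?thesis by (rule order_trans[rotated])
  next
    case False
    then have "ln (X \<omega>) \<le> 0" using that by simp
    then show ?thesis by (simp add: max_def)
  qed
  have int: "integrable M (\<lambda>\<omega>. max 0 (ln (X \<omega>)))"
  proof (rule integrableI_nonneg)
    have "(\<integral>\<^sup>+ \<omega>. ennreal (max 0 (ln (X \<omega>))) \<partial>M) \<le> (\<integral>\<^sup>+ \<omega>. (\<Sum>k. indicator (E k) \<omega>) \<partial>M)"
      by (rule nn_integral_mono_AE) (use pos le AE_space in \<open>auto elim: AE_mp\<close>)
    with fin show "(\<integral>\<^sup>+ \<omega>. ennreal (max 0 (ln (X \<omega>))) \<partial>M) < \<infinity>" by (rule le_less_trans[rotated])
  qed auto
  \<comment> \<open>Below, \<open>ln a\<close> is a bound, possibly negative. Above,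
    \<open>a + x\<^sup>2\<close> is at most \<open>(1 + a) * x\<^sup>2\<close> for
    \<open>x \<ge> 1\<close> and at most \<open>1 + a\<close> otherwise.\<close>
  have bound: "norm (ln (a + x\<^sup>2)) \<le> norm (\<bar>ln a\<bar> + ln (1 + a) + 2 * max 0 (ln x))" if "0 < x" for x
  proof -
    have "ln (a + x\<^sup>2) \<le> ln (1 + a) + 2 * max 0 (ln x)"
    proof (cases "x \<ge> 1")
      case True
      then have "a * 1 \<le> a * x\<^sup>2" using \<open>a > 0\<close> by (intro mult_left_mono) auto
      then have "a + x\<^sup>2 \<le> (1 + a) * x\<^sup>2" by (simp add: distrib_right)
      then have "ln (a + x\<^sup>2) \<le> ln ((1 + a) * x\<^sup>2)"
        using \<open>a > 0\<close> by (intro ln_mono) (auto simp: add_pos_nonneg)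
      also have "\<dots> = ln (1 + a) + 2 * ln x"
        using \<open>a > 0\<close> that by (subst ln_mult) (auto simp: ln_realpow)
      finally show ?thesis using True by simp
    next
      case False
      then have "x\<^sup>2 \<le> 1" using that by (simp add: power_le_one)
      then have "ln (a + x\<^sup>2) \<le> ln (1 + a)"
        using \<open>a > 0\<close> by (subst ln_le_cancel_iff) (auto simp: add_pos_nonneg)
      then show ?thesis by linarith
    qed
    moreover have "ln a \<le> ln (a + x\<^sup>2)"
      using \<open>a > 0\<close> by (subst ln_le_cancel_iff) (auto simp: add_pos_nonneg)
    moreover have "0 \<le> ln (1 + a)" using \<open>a > 0\<close> by simp
    ultimately show ?thesis by (auto simp: abs_if max_def split: if_splits)
  qed
  show ?thesis
  proof (rule Bochner_Integration.integrable_bound)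
    show "integrable M (\<lambda>\<omega>. \<bar>ln a\<bar> + ln (1 + a) + 2 * max 0 (ln (X \<omega>)))" using int by simp
    show "AE \<omega> in M. norm (ln (a + (X \<omega>)\<^sup>2)) \<le> norm (\<bar>ln a\<bar> + ln (1 + a) + 2 * max 0 (ln (X \<omega>)))"
      using pos by eventually_elim (rule bound)
  qed simp
qed

section \<open>Gaussian densities and their convolution\<close>

lemma borel_measurable_normal_density_params[measurable (raw)]:
  assumes [measurable]: "f \<in> borel_measurable M" "g \<in> borel_measurable M" "h \<in> borel_measurable M"
  shows "(\<lambda>x. normal_density (f x) (g x) (h x)) \<in> borel_measurable M"
  unfolding normal_density_def by measurable

lemma nn_integral_normal_law:
  assumes [measurable]: "f \<in> borel_measurable borel"
  shows "(\<integral>\<^sup>+ x. f x \<partial>normal_law m v) = (\<integral>\<^sup>+ x. ennreal (normal_density m (sqrt v) x) * f x \<partial>lborel)"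
  unfolding normal_law_def by (rule nn_integral_density) auto

text \<open>As \<open>normal_density x t y\<close> depends on \<open>y - x\<close> only, the mixture
  over the mean is the convolution of two centred Gaussians.\<close>

lemma normal_density_convolution:
  assumes "0 < s" "0 < t"
  shows "(\<integral>\<^sup>+ x. ennreal (normal_density 0 s x) * ennreal (normal_density x t y) \<partial>lborel)
    = ennreal (normal_density 0 (sqrt (s\<^sup>2 + t\<^sup>2)) y)"
  using fun_cong[OF conv_normal_density_zero_mean[OF assms(2,1)], of y]
  by (simp add: ennreal_mult'[symmetric] normal_density_def mult.commute add.commute power2_commute)

lemma normal_density_le:
  assumes "0 < s" shows "normal_density m s x \<le> 1 / sqrt (2 * pi * s\<^sup>2)"
  unfolding normal_density_def using assms
  by (intro mult_left_le) auto

lemma integrable_inverse_one_plus_square: "integrable lborel (\<lambda>x::real. 1 / (1 + x\<^sup>2))"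
  using integrable_inverse_1_plus_square by (simp add: set_integrable_def divide_inverse)

text \<open>\<open>v\<close> stands for the noise variance \<open>\<sigma>\<^sup>2 / n\<close>, and
  \<open>log_moment\<close> stands in for the tail bound. It is applied with \<open>a = v\<close>
  for the scale density and with \<open>a = 1 + v\<close> for the output density.\<close>

locale normal_scale_mixture = prob_space M
  for M :: "'a measure" and v :: real and \<Lambda> \<Theta> Y :: "'a \<Rightarrow> real" +
  assumes v_pos: "0 < v" and \<Lambda>_pos: "AE \<omega> in M. 0 < \<Lambda> \<omega>"
    and law_\<Theta>: "has_conditional_law M borel borel \<Lambda> \<Theta> (\<lambda>l. normal_law 0 (l\<^sup>2))"
    and law_Y: "has_conditional_law M (borel \<Otimes>\<^sub>M borel) borel (\<lambda>\<omega>. (\<Lambda> \<omega>, \<Theta> \<omega>)) Y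
      (\<lambda>(l, t). normal_law t v)"
    and log_moment: "\<And>a. 0 < a \<Longrightarrow> integrable M (\<lambda>\<omega>. ln (a + (\<Lambda> \<omega>)\<^sup>2))"
begin

section \<open>The densities of noise, scale channel and output\<close>

lemma measurable_variables[measurable]:
  "\<Lambda> \<in> borel_measurable M" "\<Theta> \<in> borel_measurable M" "Y \<in> borel_measurable M"
  using law_\<Theta> law_Y by (auto simp: has_conditional_law_def)

definition noise_density :: "real \<times> real \<Rightarrow> real" where
  "noise_density z = normal_density (fst z) (sqrt v) (snd z)"

definition scale_density :: "real \<times> real \<Rightarrow> real" where
  "scale_density z = normal_density 0 (sqrt ((fst z)\<^sup>2 + v)) (snd z)"

text \<open>A real-valued integral is safe here: the integrand is bounded by the peak of the
  Gaussian, so the default value for non-integrable functions never occurs.\<close>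

definition output_density :: "real \<Rightarrow> real" where
  "output_density y = (\<integral>\<omega>. noise_density (\<Theta> \<omega>, y) \<partial>M)"

lemma measurable_densities[measurable]:
  "noise_density \<in> borel_measurable (borel \<Otimes>\<^sub>M borel)"
  "scale_density \<in> borel_measurable (borel \<Otimes>\<^sub>M borel)"
  "output_density \<in> borel_measurable borel"
  unfolding noise_density_def scale_density_def output_density_def by measurable

lemma noise_density_pos: "0 < noise_density z"
  unfolding noise_density_def using v_pos by (intro normal_density_pos) simp

lemma scale_density_pos: "0 < scale_density z"
  unfolding scale_density_def using v_pos by (intro normal_density_pos) (simp add: add_nonneg_pos)

lemma densities_nonzero[simp]: "noise_density z \<noteq> 0" "scale_density z \<noteq> 0"
  using noise_density_pos[of z] scale_density_pos[of z] by simp_all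

lemma integrable_noise_density: "integrable M (\<lambda>\<omega>. noise_density (\<Theta> \<omega>, y))"
  using noise_density_pos normal_density_le[of "sqrt v"] v_pos
  by (intro integrable_const_bound[where B="1 / sqrt (2 * pi * v)"])
     (auto simp: less_imp_le noise_density_def)

lemma output_density_pos: "0 < output_density y"
proof -
  have "output_density y \<noteq> 0"
    unfolding output_density_def
    using integrable_noise_density noise_density_pos[of "(_, y)"]
    by (subst integral_nonneg_eq_0_iff_AE)
       (auto simp: less_imp_le less_imp_neq[symmetric] AE_False)
  moreover have "0 \<le> output_density y"
    unfolding output_density_def by (simp add: less_imp_le noise_density_pos)
  ultimately show ?thesis by simp
qed

lemma output_density_nonzero[simp]: "output_density y \<noteq> 0"
  using output_density_pos[of y] by simp

lemma output_density_le: "output_density y \<le> 1 / sqrt (2 * pi * v)"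
  unfolding output_density_def
  using integrable_noise_density normal_density_le[of "sqrt v"] v_pos
  by (intro integral_le_const) (auto simp: noise_density_def)

section \<open>The channels from \<open>\<Theta>\<close> and from \<open>\<Lambda>\<close> to
  \<open>Y\<close>\<close>

lemma nn_integral_\<Theta>:
  assumes [measurable]: "f \<in> borel_measurable (borel \<Otimes>\<^sub>M borel)"
  shows "(\<integral>\<^sup>+ \<omega>. f (\<Lambda> \<omega>, \<Theta> \<omega>) \<partial>M)
    = (\<integral>\<^sup>+ \<omega>. \<integral>\<^sup>+ t. ennreal (normal_density 0 \<bar>\<Lambda> \<omega>\<bar> t) * f (\<Lambda> \<omega>, t) \<partial>lborel \<partial>M)"
  by (subst nn_integral_conditional_law[OF prob_space_axioms law_\<Theta>])
     (simp_all add: nn_integral_normal_law)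

lemma nn_integral_Y:
  assumes [measurable]: "f \<in> borel_measurable ((borel \<Otimes>\<^sub>M borel) \<Otimes>\<^sub>M borel)"
  shows "(\<integral>\<^sup>+ \<omega>. f ((\<Lambda> \<omega>, \<Theta> \<omega>), Y \<omega>) \<partial>M)
    = (\<integral>\<^sup>+ \<omega>. \<integral>\<^sup>+ y. ennreal (noise_density (\<Theta> \<omega>, y)) * f ((\<Lambda> \<omega>, \<Theta> \<omega>), y) \<partial>lborel \<partial>M)"
  by (subst nn_integral_conditional_law[OF prob_space_axioms law_Y])
     (simp_all add: nn_integral_normal_law noise_density_def)

text \<open>The Markov property: the kernel of \<open>Y\<close> given both variables does not
  involve the scale, so test functions that ignore the scale yield a channel from
  \<open>\<Theta>\<close> alone.\<close>

sublocale \<Theta>: channel M borel \<Theta> Y noise_density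
proof
  fix f :: "real \<times> real \<Rightarrow> ennreal" assume [measurable]: "f \<in> borel_measurable (borel \<Otimes>\<^sub>M borel)"
  show "(\<integral>\<^sup>+ \<omega>. f (\<Theta> \<omega>, Y \<omega>) \<partial>M)
      = (\<integral>\<^sup>+ \<omega>. \<integral>\<^sup>+ y. ennreal (noise_density (\<Theta> \<omega>, y)) * f (\<Theta> \<omega>, y) \<partial>lborel \<partial>M)"
    using nn_integral_Y[of "\<lambda>z. f (snd (fst z), snd z)"] by simp
qed (auto simp: less_imp_le noise_density_pos)

text \<open>Tonelli moves the integral over \<open>t\<close> inside, where the Gaussian convolution
  adds the variances \<open>l\<^sup>2\<close> and \<open>v\<close>; \<open>f\<close> does not depend
  on \<open>t\<close>.\<close>

lemma nn_integral_scale_density: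
  fixes f :: "real \<times> real \<Rightarrow> ennreal"
  assumes [measurable]: "f \<in> borel_measurable (borel \<Otimes>\<^sub>M borel)" and "0 < l"
  shows "(\<integral>\<^sup>+ t. ennreal (normal_density 0 \<bar>l\<bar> t) *
      (\<integral>\<^sup>+ y. ennreal (noise_density (t, y)) * f (l, y) \<partial>lborel) \<partial>lborel)
    = (\<integral>\<^sup>+ y. ennreal (scale_density (l, y)) * f (l, y) \<partial>lborel)"
proof -
  have "(\<integral>\<^sup>+ t. ennreal (normal_density 0 \<bar>l\<bar> t) *
      (\<integral>\<^sup>+ y. ennreal (noise_density (t, y)) * f (l, y) \<partial>lborel) \<partial>lborel)
    = (\<integral>\<^sup>+ t. \<integral>\<^sup>+ y. ennreal (normal_density 0 l t) * ennreal (noise_density (t, y)) * f (l, y) \<partial>lborel \<partial>lborel)"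
    using \<open>0 < l\<close> by (simp add: nn_integral_cmult[symmetric] mult.assoc)
  also have "\<dots> = (\<integral>\<^sup>+ y. \<integral>\<^sup>+ t. ennreal (normal_density 0 l t) * ennreal (noise_density (t, y)) * f (l, y) \<partial>lborel \<partial>lborel)"
    by (rule lborel_pair.Fubini') simp
  also have "\<dots> = (\<integral>\<^sup>+ y. ennreal (scale_density (l, y)) * f (l, y) \<partial>lborel)"
    using \<open>0 < l\<close> v_pos normal_density_convolution[of l "sqrt v"]
    by (simp add: nn_integral_multc noise_density_def scale_density_def)
  finally show ?thesis .
qed

sublocale \<Lambda>: channel M borel \<Lambda> Y scale_density
proof
  fix f :: "real \<times> real \<Rightarrow> ennreal" assume [measurable]: "f \<in> borel_measurable (borel \<Otimes>\<^sub>M borel)"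
  have "(\<integral>\<^sup>+ \<omega>. f (\<Lambda> \<omega>, Y \<omega>) \<partial>M)
      = (\<integral>\<^sup>+ \<omega>. \<integral>\<^sup>+ y. ennreal (noise_density (\<Theta> \<omega>, y)) * f (\<Lambda> \<omega>, y) \<partial>lborel \<partial>M)"
    using nn_integral_Y[of "\<lambda>z. f (fst (fst z), snd z)"] by simp
  also have "\<dots> = (\<integral>\<^sup>+ \<omega>. \<integral>\<^sup>+ t. ennreal (normal_density 0 \<bar>\<Lambda> \<omega>\<bar> t) *
      (\<integral>\<^sup>+ y. ennreal (noise_density (t, y)) * f (\<Lambda> \<omega>, y) \<partial>lborel) \<partial>lborel \<partial>M)"
    using nn_integral_\<Theta>[of "\<lambda>z. \<integral>\<^sup>+ y. ennreal (noise_density (snd z, y)) * f (fst z, y) \<partial>lborel"] by simp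
  also have "\<dots> = (\<integral>\<^sup>+ \<omega>. \<integral>\<^sup>+ y. ennreal (scale_density (\<Lambda> \<omega>, y)) * f (\<Lambda> \<omega>, y) \<partial>lborel \<partial>M)"
    by (rule nn_integral_cong_AE) (use \<Lambda>_pos nn_integral_scale_density in auto)
  finally show "(\<integral>\<^sup>+ \<omega>. f (\<Lambda> \<omega>, Y \<omega>) \<partial>M)
      = (\<integral>\<^sup>+ \<omega>. \<integral>\<^sup>+ y. ennreal (scale_density (\<Lambda> \<omega>, y)) * f (\<Lambda> \<omega>, y) \<partial>lborel \<partial>M)" .
qed (auto simp: less_imp_le scale_density_pos)

lemma distr_Y: "distr M borel Y = density lborel output_density"
  unfolding output_density_def[abs_def]
  using integrable_noise_density noise_density_pos
  by (intro \<Theta>.distr_output_eq_density)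
     (auto simp: nn_integral_eq_integral less_imp_le measurable_densities(3)[unfolded output_density_def[abs_def]])

section \<open>Integrability of the three log-densities\<close>

lemma integrable_ln_scale: "integrable M (\<lambda>\<omega>. ln (sqrt ((\<Lambda> \<omega>)\<^sup>2 + v)))"
  using log_moment[OF v_pos] v_pos by (simp add: ln_sqrt add_nonneg_pos add.commute)

lemma ln_noise_density:
  "has_bochner_integral M (\<lambda>\<omega>. ln (noise_density (\<Theta> \<omega>, Y \<omega>))) (- ln (sqrt v) - ln (2 * pi) / 2 - 1 / 2)"
  using \<Theta>.has_bochner_integral_ln_normal_channel(2)[of "\<lambda>x. x" "\<lambda>_. sqrt v"] v_pos
  by (simp add: noise_density_def prob_space)

lemma ln_scale_density:
  "has_bochner_integral M (\<lambda>\<omega>. (Y \<omega>)\<^sup>2 / ((\<Lambda> \<omega>)\<^sup>2 + v)) 1"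
  "has_bochner_integral M (\<lambda>\<omega>. ln (scale_density (\<Lambda> \<omega>, Y \<omega>)))
    (- (\<integral>\<omega>. ln (sqrt ((\<Lambda> \<omega>)\<^sup>2 + v)) \<partial>M) - ln (2 * pi) / 2 - 1 / 2)"
  using \<Lambda>.has_bochner_integral_ln_normal_channel[of "\<lambda>_. 0" "\<lambda>l. sqrt (l\<^sup>2 + v)"]
    integrable_ln_scale v_pos
  by (simp_all add: scale_density_def power_divide add_nonneg_pos)

lemma integrable_ln_output_density: "integrable M (\<lambda>\<omega>. ln (output_density (Y \<omega>)))"
proof -
  let ?B = "1 / sqrt (2 * pi * v)"
  let ?r = "\<lambda>y. 1 / (1 + y\<^sup>2) / output_density y"
  \<comment> \<open>Under the law of \<open>Y\<close> the denominator cancels against the density,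
    which leaves the Cauchy-type function \<open>1 / (1 + y\<^sup>2)\<close> on the Lebesgue
    line.\<close>
  have "integrable (distr M borel Y) ?r"
    unfolding distr_Y using integrable_inverse_one_plus_square output_density_pos
    by (subst integrable_density) (auto simp: less_imp_le)
  then have ir: "integrable M (\<lambda>\<omega>. ?r (Y \<omega>))"
    by (subst (asm) integrable_distr_eq) auto
  have i2: "integrable M (\<lambda>\<omega>. ln (1 + v + (\<Lambda> \<omega>)\<^sup>2) + (Y \<omega>)\<^sup>2 / ((\<Lambda> \<omega>)\<^sup>2 + v))"
    using log_moment[of "1 + v"] v_pos ln_scale_density(1) by (auto simp: has_bochner_integral_iff)
  have upper: "ln (output_density y) \<le> ln ?B" for y
    using output_density_pos output_density_le v_pos by (intro ln_mono) auto
  \<comment> \<open>The bound is deterministic, with \<open>l\<close> a free parameter. Only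
    afterwards is \<open>l\<close> replaced by the random scale, which normalises
    \<open>y\<^sup>2\<close> to something of finite expectation even when \<open>Y\<close> itself
    has no second moment.\<close>
  have lower: "- ln (output_density y) \<le> ?r y + (ln (1 + v + l\<^sup>2) + y\<^sup>2 / (l\<^sup>2 + v))" for y l
  proof -
    have L: "0 < l\<^sup>2 + v" using v_pos by (simp add: add_nonneg_pos)
    have y: "0 < 1 + y\<^sup>2" by (simp add: add_pos_nonneg)
    have "ln (?r y) \<le> ?r y - 1"
      using output_density_pos[of y] y by (intro ln_le_minus_one) auto
    moreover have "ln (?r y) = - ln (1 + y\<^sup>2) - ln (output_density y)"
      using output_density_pos[of y] y by (simp add: ln_div ln_mult)
    \<comment> \<open>With \<open>L = l\<^sup>2 + v\<close> the product expands to
      \<open>1 + L + y\<^sup>2 / L + y\<^sup>2\<close>, and the two middle terms are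
      nonnegative.\<close>
    moreover have "ln (1 + y\<^sup>2) \<le> ln ((1 + v + l\<^sup>2) * (1 + y\<^sup>2 / (l\<^sup>2 + v)))"
    proof (rule ln_mono[OF _ y])
      have "(1 + v + l\<^sup>2) * (1 + y\<^sup>2 / (l\<^sup>2 + v)) = 1 + (l\<^sup>2 + v) + y\<^sup>2 / (l\<^sup>2 + v) + y\<^sup>2"
        using L by (simp add: field_simps)
      moreover have "0 \<le> y\<^sup>2 / (l\<^sup>2 + v)" using L by simp
      ultimately show "1 + y\<^sup>2 \<le> (1 + v + l\<^sup>2) * (1 + y\<^sup>2 / (l\<^sup>2 + v))" using L by linarith
    qed
    moreover have p: "1 + v + l\<^sup>2 \<noteq> 0" "1 + y\<^sup>2 / (l\<^sup>2 + v) \<noteq> 0"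
      using L divide_nonneg_pos[OF zero_le_power2[of y] L] by linarith+
    moreover have "ln ((1 + v + l\<^sup>2) * (1 + y\<^sup>2 / (l\<^sup>2 + v))) = ln (1 + v + l\<^sup>2) + ln (1 + y\<^sup>2 / (l\<^sup>2 + v))"
      using L p by (simp add: ln_mult)
    moreover have "ln (1 + y\<^sup>2 / (l\<^sup>2 + v)) \<le> y\<^sup>2 / (l\<^sup>2 + v)"
      using L by (intro ln_add_one_self_le_self) auto
    ultimately show ?thesis by linarith
  qed
  show ?thesis
  proof (rule Bochner_Integration.integrable_bound)
    show "integrable M (\<lambda>\<omega>. \<bar>ln ?B\<bar> + \<bar>?r (Y \<omega>) + (ln (1 + v + (\<Lambda> \<omega>)\<^sup>2) + (Y \<omega>)\<^sup>2 / ((\<Lambda> \<omega>)\<^sup>2 + v))\<bar>)"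
      by (intro Bochner_Integration.integrable_add[OF integrable_const]
          integrable_abs Bochner_Integration.integrable_add[OF ir i2])
    show "AE \<omega> in M. norm (ln (output_density (Y \<omega>)))
      \<le> norm (\<bar>ln ?B\<bar> + \<bar>?r (Y \<omega>) + (ln (1 + v + (\<Lambda> \<omega>)\<^sup>2) + (Y \<omega>)\<^sup>2 / ((\<Lambda> \<omega>)\<^sup>2 + v))\<bar>)"
    proof (rule AE_I2)
      fix \<omega>
      show "norm (ln (output_density (Y \<omega>)))
        \<le> norm (\<bar>ln ?B\<bar> + \<bar>?r (Y \<omega>) + (ln (1 + v + (\<Lambda> \<omega>)\<^sup>2) + (Y \<omega>)\<^sup>2 / ((\<Lambda> \<omega>)\<^sup>2 + v))\<bar>)"
        using upper[of "Y \<omega>"] lower[of "Y \<omega>" "\<Lambda> \<omega>"] unfolding real_norm_def by linarith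
    qed
  qed measurable
qed

section \<open>The conditional law of \<open>(\<Theta>, Y)\<close> given the scale\<close>

text \<open>An explicit version of the kernel, defined for all real \<open>l\<close>. The absolute
  value is the square root of the variance \<open>l\<^sup>2\<close>; at \<open>l = 0\<close> the
  measure is zero, which a sub-stochastic kernel permits.\<close>

definition cond_law :: "real \<Rightarrow> (real \<times> real) measure" where
  "cond_law l = density (lborel \<Otimes>\<^sub>M lborel) (\<lambda>z. normal_density 0 \<bar>l\<bar> (fst z) * noise_density z)"

lemma sets_cond_law[simp, measurable_cong]: "sets (cond_law l) = sets (borel \<Otimes>\<^sub>M borel)"
  unfolding cond_law_def sets_density by (rule sets_pair_measure_cong) simp_all

lemma nn_integral_cond_law:
  assumes [measurable]: "f \<in> borel_measurable (borel \<Otimes>\<^sub>M borel)"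
  shows "(\<integral>\<^sup>+ z. f z \<partial>cond_law l) = (\<integral>\<^sup>+ t. ennreal (normal_density 0 \<bar>l\<bar> t) *
    (\<integral>\<^sup>+ y. ennreal (noise_density (t, y)) * f (t, y) \<partial>lborel) \<partial>lborel)"
proof -
  have "(\<integral>\<^sup>+ z. f z \<partial>cond_law l) =
      (\<integral>\<^sup>+ z. ennreal (normal_density 0 \<bar>l\<bar> (fst z) * noise_density z) * f z \<partial>(lborel \<Otimes>\<^sub>M lborel))"
    unfolding cond_law_def by (rule nn_integral_density) measurable
  also have "\<dots> = (\<integral>\<^sup>+ t. \<integral>\<^sup>+ y. ennreal (normal_density 0 \<bar>l\<bar> t * noise_density (t, y)) * f (t, y) \<partial>lborel \<partial>lborel)"
    by (subst lborel.nn_integral_fst[symmetric]) simp_all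
  also have "\<dots> = (\<integral>\<^sup>+ t. ennreal (normal_density 0 \<bar>l\<bar> t) *
      (\<integral>\<^sup>+ y. ennreal (noise_density (t, y)) * f (t, y) \<partial>lborel) \<partial>lborel)"
    using noise_density_pos
    by (simp add: nn_integral_cmult[symmetric] ennreal_mult less_imp_le mult.assoc)
  finally show ?thesis .
qed

lemma nn_integral_noise_density: "(\<integral>\<^sup>+ y. ennreal (noise_density (t, y)) \<partial>lborel) = 1"
  using v_pos by (simp add: noise_density_def nn_integral_eq_integral)

lemma nn_integral_cond_law_fst:
  assumes [measurable]: "f \<in> borel_measurable borel"
  shows "(\<integral>\<^sup>+ z. f (fst z) \<partial>cond_law l) = (\<integral>\<^sup>+ t. ennreal (normal_density 0 \<bar>l\<bar> t) * f t \<partial>lborel)"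
  using nn_integral_cond_law[of "\<lambda>z. f (fst z)" l]
  by (simp add: nn_integral_multc nn_integral_noise_density)

text \<open>\<^const>\<open>normal_density\<close> vanishes when the standard deviation is \<open>0\<close>.\<close>

lemma emeasure_cond_law_space:
  "emeasure (cond_law l) (space (cond_law l)) = (if l = 0 then 0 else 1)"
proof -
  have "emeasure (cond_law l) (space (cond_law l)) = (\<integral>\<^sup>+ z. 1 \<partial>cond_law l)" by simp
  also have "\<dots> = (\<integral>\<^sup>+ t. ennreal (normal_density 0 \<bar>l\<bar> t) \<partial>lborel)"
    using nn_integral_cond_law_fst[of "\<lambda>_. 1" l] by simp
  also have "\<dots> = (if l = 0 then 0 else 1)"
    by (auto simp: nn_integral_eq_integral) (simp add: normal_density_def)
  finally show ?thesis .
qed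

lemma prob_space_cond_law: "l \<noteq> 0 \<Longrightarrow> prob_space (cond_law l)"
  by (rule prob_spaceI) (simp add: emeasure_cond_law_space)

text \<open>The two kernels of the model are applied in turn: first \<open>Y\<close> is integrated
  out given \<open>(\<Lambda>, \<Theta>)\<close>, then \<open>\<Theta>\<close> given
  \<open>\<Lambda>\<close>.\<close>

lemma has_conditional_law_cond_law:
  "has_conditional_law M borel (borel \<Otimes>\<^sub>M borel) \<Lambda> (\<lambda>\<omega>. (\<Theta> \<omega>, Y \<omega>)) cond_law"
  unfolding has_conditional_law_def
proof (intro conjI ballI)
  show K[measurable]: "cond_law \<in> borel \<rightarrow>\<^sub>M subprob_algebra (borel \<Otimes>\<^sub>M borel)"
  proof (rule measurable_subprob_algebra)
    show "subprob_space (cond_law l)" for l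
      by (rule subprob_spaceI)
        (simp_all add: emeasure_cond_law_space, simp add: sets_eq_imp_space_eq[OF sets_cond_law] space_pair_measure)
    fix A :: "(real \<times> real) set" assume [measurable]: "A \<in> sets (borel \<Otimes>\<^sub>M borel)"
    have "emeasure (cond_law l) A = (\<integral>\<^sup>+ t. ennreal (normal_density 0 \<bar>l\<bar> t) *
        (\<integral>\<^sup>+ y. ennreal (noise_density (t, y)) * indicator A (t, y) \<partial>lborel) \<partial>lborel)" for l
      using nn_integral_cond_law[of "indicator A" l] by simp
    then show "(\<lambda>l. emeasure (cond_law l) A) \<in> borel_measurable borel" by simp
  qed simp
  fix A :: "real set" and B :: "(real \<times> real) set"
  assume [measurable]: "A \<in> sets borel" "B \<in> sets (borel \<Otimes>\<^sub>M borel)"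
  let ?E = "{\<omega> \<in> space M. \<Lambda> \<omega> \<in> A \<and> (\<Theta> \<omega>, Y \<omega>) \<in> B}"
  have "emeasure M ?E = (\<integral>\<^sup>+ \<omega>. indicator ?E \<omega> \<partial>M)" by simp
  also have "\<dots> = (\<integral>\<^sup>+ \<omega>. indicator A (\<Lambda> \<omega>) * indicator B (\<Theta> \<omega>, Y \<omega>) \<partial>M)"
    by (rule nn_integral_cong) (auto split: split_indicator)
  also have "\<dots> = (\<integral>\<^sup>+ \<omega>. \<integral>\<^sup>+ y. ennreal (noise_density (\<Theta> \<omega>, y)) *
      (indicator A (\<Lambda> \<omega>) * indicator B (\<Theta> \<omega>, y)) \<partial>lborel \<partial>M)"
    using nn_integral_Y[of "\<lambda>z. indicator A (fst (fst z)) * indicator B (snd (fst z), snd z)"] by simp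
  also have "\<dots> = (\<integral>\<^sup>+ \<omega>. \<integral>\<^sup>+ t. ennreal (normal_density 0 \<bar>\<Lambda> \<omega>\<bar> t) *
      (\<integral>\<^sup>+ y. ennreal (noise_density (t, y)) * (indicator A (\<Lambda> \<omega>) * indicator B (t, y)) \<partial>lborel) \<partial>lborel \<partial>M)"
    using nn_integral_\<Theta>[of "\<lambda>z. \<integral>\<^sup>+ y. ennreal (noise_density (snd z, y)) *
      (indicator A (fst z) * indicator B (snd z, y)) \<partial>lborel"] by simp
  also have "\<dots> = (\<integral>\<^sup>+ \<omega>. emeasure (cond_law (\<Lambda> \<omega>)) B * indicator A (\<Lambda> \<omega>) \<partial>M)"
  proof (rule nn_integral_cong)
    fix \<omega>
    show "(\<integral>\<^sup>+ t. ennreal (normal_density 0 \<bar>\<Lambda> \<omega>\<bar> t) * (\<integral>\<^sup>+ y. ennreal (noise_density (t, y)) *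
        (indicator A (\<Lambda> \<omega>) * indicator B (t, y)) \<partial>lborel) \<partial>lborel)
      = emeasure (cond_law (\<Lambda> \<omega>)) B * indicator A (\<Lambda> \<omega>)"
      using nn_integral_cond_law[of "indicator B" "\<Lambda> \<omega>"]
      by (simp split: split_indicator)
  qed
  also have "\<dots> = (\<integral>\<^sup>+ l\<in>A. emeasure (cond_law l) B \<partial>distr M borel \<Lambda>)"
    by (subst nn_integral_distr) (auto intro!: measurable_emeasure_kernel[OF K])
  finally show "emeasure M ?E
    = (\<integral>\<^sup>+ l\<in>A. emeasure (cond_law l) B \<partial>distr M borel \<Lambda>)" .
qed measurable

text \<open>For a fixed scale this is the Gaussian channel. The expected log-densities of noise and
  output share the terms \<open>- ln (2 * pi) / 2 - 1 / 2\<close>, so only the logarithms of the two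
  standard deviations survive.\<close>

lemma mutual_info_cond_law:
  assumes "0 < l"
  shows "mutual_info (cond_law l) borel borel fst snd = ennreal (ln (sqrt (l\<^sup>2 + v)) - ln (sqrt v))"
proof -
  interpret K: prob_space "cond_law l" using assms by (simp add: prob_space_cond_law)
  interpret F: channel "cond_law l" borel fst snd noise_density
  proof
    fix f :: "real \<times> real \<Rightarrow> ennreal" assume [measurable]: "f \<in> borel_measurable (borel \<Otimes>\<^sub>M borel)"
    show "(\<integral>\<^sup>+ z. f (fst z, snd z) \<partial>cond_law l)
        = (\<integral>\<^sup>+ z. \<integral>\<^sup>+ y. ennreal (noise_density (fst z, y)) * f (fst z, y) \<partial>lborel \<partial>cond_law l)"
      using nn_integral_cond_law[of f l]
        nn_integral_cond_law_fst[of "\<lambda>t. \<integral>\<^sup>+ y. ennreal (noise_density (t, y)) * f (t, y) \<partial>lborel" l]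
      by simp
  qed (auto simp: less_imp_le noise_density_pos)
  \<comment> \<open>A channel with constant input merely records that the second coordinate has
    density \<open>scale_density (l, _)\<close>, so the general results on channels also supply its
    marginal law and its expected log-density.\<close>
  interpret L: channel "cond_law l" borel "\<lambda>_. l" snd scale_density
  proof
    fix f :: "real \<times> real \<Rightarrow> ennreal" assume [measurable]: "f \<in> borel_measurable (borel \<Otimes>\<^sub>M borel)"
    show "(\<integral>\<^sup>+ z. f (l, snd z) \<partial>cond_law l)
        = (\<integral>\<^sup>+ z. \<integral>\<^sup>+ y. ennreal (scale_density (l, y)) * f (l, y) \<partial>lborel \<partial>cond_law l)"
      using nn_integral_cond_law[of "\<lambda>z. f (l, snd z)" l] nn_integral_scale_density[of f l] assms
      by (simp add: K.emeasure_space_1)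
  qed (auto simp: less_imp_le scale_density_pos)
  have noise: "has_bochner_integral (cond_law l) (\<lambda>z. ln (noise_density (fst z, snd z)))
      (- ln (sqrt v) - ln (2 * pi) / 2 - 1 / 2)"
    using F.has_bochner_integral_ln_normal_channel(2)[of "\<lambda>x. x" "\<lambda>_. sqrt v"] v_pos
    by (simp add: noise_density_def K.prob_space)
  have scale: "has_bochner_integral (cond_law l) (\<lambda>z. ln (scale_density (l, snd z)))
      (- ln (sqrt (l\<^sup>2 + v)) - ln (2 * pi) / 2 - 1 / 2)"
    using L.has_bochner_integral_ln_normal_channel(2)[of "\<lambda>_. 0" "\<lambda>l. sqrt (l\<^sup>2 + v)"] v_pos
    by (simp add: scale_density_def K.prob_space add_nonneg_pos)
  have "has_bochner_integral (cond_law l)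
      (\<lambda>z. ln (noise_density (fst z, snd z) / scale_density (l, snd z)))
      (ln (sqrt (l\<^sup>2 + v)) - ln (sqrt v))"
    using has_bochner_integral_diff[OF noise scale] noise_density_pos scale_density_pos
    by (simp add: ln_div)
  moreover have "distr (cond_law l) borel snd = density lborel (\<lambda>y. scale_density (l, y))"
    by (rule L.distr_output_eq_density) (simp_all add: K.emeasure_space_1)
  ultimately show ?thesis
    using F.mutual_info_eq[of "\<lambda>y. scale_density (l, y)"] scale_density_pos
    by (simp add: has_bochner_integral_iff)
qed

lemma cond_mutual_info_eq:
  "cond_mutual_info M borel borel borel \<Theta> Y \<Lambda>
    = ennreal (\<integral>\<omega>. ln (sqrt ((\<Lambda> \<omega>)\<^sup>2 + v)) - ln (sqrt v) \<partial>M)"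
proof -
  define K where "K = (SOME K. has_conditional_law M borel (borel \<Otimes>\<^sub>M borel) \<Lambda> (\<lambda>\<omega>. (\<Theta> \<omega>, Y \<omega>)) K)"
  have "has_conditional_law M borel (borel \<Otimes>\<^sub>M borel) \<Lambda> (\<lambda>\<omega>. (\<Theta> \<omega>, Y \<omega>)) K"
    unfolding K_def using has_conditional_law_cond_law by (rule someI[of "has_conditional_law _ _ _ _ _"])
  then have "AE l in distr M borel \<Lambda>. K l = cond_law l"
    \<comment> \<open>Uniqueness is stated for a target \<open>borel\<close>;
      \<open>borel_prod\<close> identifies the product of the two Borel spaces with it.\<close>
    using has_conditional_law_cond_law unfolding borel_prod
    by (rule has_conditional_law_unique[OF prob_space_axioms])
  moreover have "AE l in distr M borel \<Lambda>. 0 < l"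
    using \<Lambda>_pos by (subst AE_distr_iff) auto
  ultimately have "AE l in distr M borel \<Lambda>. mutual_info (K l) borel borel fst snd
      = ennreal (ln (sqrt (l\<^sup>2 + v)) - ln (sqrt v))"
    by eventually_elim (simp add: mutual_info_cond_law)
  then have "cond_mutual_info M borel borel borel \<Theta> Y \<Lambda>
      = (\<integral>\<^sup>+ l. ennreal (ln (sqrt (l\<^sup>2 + v)) - ln (sqrt v)) \<partial>distr M borel \<Lambda>)"
    unfolding cond_mutual_info_def K_def[symmetric] Let_def by (rule nn_integral_cong_AE)
  also have "\<dots> = (\<integral>\<^sup>+ \<omega>. ennreal (ln (sqrt ((\<Lambda> \<omega>)\<^sup>2 + v)) - ln (sqrt v)) \<partial>M)"
    by (subst nn_integral_distr) auto
  also have "\<dots> = ennreal (\<integral>\<omega>. ln (sqrt ((\<Lambda> \<omega>)\<^sup>2 + v)) - ln (sqrt v) \<partial>M)"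
    \<comment> \<open>The integrand is nonnegative because \<open>sqrt v\<close> is at most
      \<open>sqrt ((\<Lambda> \<omega>)\<^sup>2 + v)\<close>, so \<open>ennreal\<close> truncates
      nothing.\<close>
    using integrable_ln_scale v_pos
    by (intro nn_integral_eq_integral) (auto intro!: AE_I2 ln_mono)
  finally show ?thesis .
qed

section \<open>The decomposition and its finiteness\<close>

lemma mutual_info_decomposition:
  "mutual_info M borel borel \<Theta> Y =
    mutual_info M borel borel \<Lambda> Y + cond_mutual_info M borel borel borel \<Theta> Y \<Lambda>"
  "mutual_info M borel borel \<Theta> Y < \<infinity>"
proof -
  define i\<^sub>\<Theta> i\<^sub>\<Lambda> c where
    "i\<^sub>\<Theta> = (\<integral>\<omega>. ln (noise_density (\<Theta> \<omega>, Y \<omega>) / output_density (Y \<omega>)) \<partial>M)" and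
    "i\<^sub>\<Lambda> = (\<integral>\<omega>. ln (scale_density (\<Lambda> \<omega>, Y \<omega>) / output_density (Y \<omega>)) \<partial>M)" and
    "c = (\<integral>\<omega>. ln (sqrt ((\<Lambda> \<omega>)\<^sup>2 + v)) - ln (sqrt v) \<partial>M)"
  have eq: "(\<lambda>\<omega>. ln (noise_density (\<Theta> \<omega>, Y \<omega>) / output_density (Y \<omega>)))
      = (\<lambda>\<omega>. ln (noise_density (\<Theta> \<omega>, Y \<omega>)) - ln (output_density (Y \<omega>)))"
    "(\<lambda>\<omega>. ln (scale_density (\<Lambda> \<omega>, Y \<omega>) / output_density (Y \<omega>)))
      = (\<lambda>\<omega>. ln (scale_density (\<Lambda> \<omega>, Y \<omega>)) - ln (output_density (Y \<omega>)))"
    using noise_density_pos scale_density_pos output_density_pos by (auto simp: ln_div)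
  note int = ln_noise_density ln_scale_density(2) integrable_ln_output_density
  have int\<^sub>\<Theta>: "integrable M (\<lambda>\<omega>. ln (noise_density (\<Theta> \<omega>, Y \<omega>) / output_density (Y \<omega>)))"
    and int\<^sub>\<Lambda>: "integrable M (\<lambda>\<omega>. ln (scale_density (\<Lambda> \<omega>, Y \<omega>) / output_density (Y \<omega>)))"
    unfolding eq using int by (auto simp: has_bochner_integral_iff)
  have \<Theta>: "mutual_info M borel borel \<Theta> Y = ennreal i\<^sub>\<Theta>"
    unfolding i\<^sub>\<Theta>_def using output_density_pos distr_Y int\<^sub>\<Theta> by (intro \<Theta>.mutual_info_eq) auto
  have \<Lambda>: "mutual_info M borel borel \<Lambda> Y = ennreal i\<^sub>\<Lambda>"
    unfolding i\<^sub>\<Lambda>_def using output_density_pos distr_Y int\<^sub>\<Lambda> by (intro \<Lambda>.mutual_info_eq) auto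
  have "0 \<le> i\<^sub>\<Lambda>"
    unfolding i\<^sub>\<Lambda>_def using output_density_pos distr_Y int\<^sub>\<Lambda> scale_density_pos
    by (intro \<Lambda>.expectation_ln_ratio_nonneg) auto
  moreover have "0 \<le> c"
    unfolding c_def using v_pos by (intro integral_nonneg_AE AE_I2) (auto intro!: ln_mono)
  \<comment> \<open>The output term \<open>ln (output_density (Y \<omega>))\<close> cancels in the
    difference; its integrability makes this subtraction legitimate. The Gaussian constants cancel
    as well.\<close>
  moreover have "i\<^sub>\<Theta> = i\<^sub>\<Lambda> + c"
    unfolding i\<^sub>\<Theta>_def i\<^sub>\<Lambda>_def c_def eq using int integrable_ln_scale
    by (simp add: has_bochner_integral_iff prob_space)
  ultimately show "mutual_info M borel borel \<Theta> Y =
    mutual_info M borel borel \<Lambda> Y + cond_mutual_info M borel borel borel \<Theta> Y \<Lambda>"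
    unfolding \<Theta> \<Lambda> cond_mutual_info_eq c_def[symmetric] by (simp add: ennreal_plus)
  show "mutual_info M borel borel \<Theta> Y < \<infinity>" unfolding \<Theta> by simp
qed

end

theorem proposition7:
  fixes M :: "'a measure" and \<Lambda> \<Theta> Y :: "'a \<Rightarrow> real" and \<sigma> \<alpha> t\<^sub>0 C :: real and n :: nat
  assumes "\<sigma> > 0" and "n \<ge> 1"
    and model: "scale_mixture_model M \<sigma> n \<Lambda> \<Theta> Y"
    and "\<alpha> > 0" and "t\<^sub>0 \<ge> 1" and "C > 0"
    and tail: "\<And>t. t \<ge> t\<^sub>0 \<Longrightarrow> measure M {\<omega> \<in> space M. \<Lambda> \<omega> \<ge> t} \<le> C * t powr (- \<alpha>)"
  shows "mutual_info M borel borel \<Theta> Y < \<infinity> \<and>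
    mutual_info M borel borel \<Theta> Y =
      mutual_info M borel borel \<Lambda> Y + cond_mutual_info M borel borel borel \<Theta> Y \<Lambda> \<and>
    mutual_info M borel borel \<Lambda> Y < \<infinity> \<and>
    cond_mutual_info M borel borel borel \<Theta> Y \<Lambda> < \<infinity>"
proof -
  interpret prob_space M using model by (simp add: scale_mixture_model_def)
  interpret normal_scale_mixture M "\<sigma>\<^sup>2 / real n" \<Lambda> \<Theta> Y
  proof
    show "0 < \<sigma>\<^sup>2 / real n" using \<open>\<sigma> > 0\<close> \<open>n \<ge> 1\<close> by simp
    \<comment> \<open>The polynomial tail is converted here into the logarithmic moment on which the
      rest is built.\<close>
    show "integrable M (\<lambda>\<omega>. ln (a + (\<Lambda> \<omega>)\<^sup>2))" if "0 < a" for a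
      using model tail by (intro integrable_ln_of_polynomial_tail[OF _ that \<open>\<alpha> > 0\<close>, of _ t\<^sub>0 C])
        (auto simp: scale_mixture_model_def)
  qed (use model in \<open>simp_all add: scale_mixture_model_def\<close>)
  show ?thesis
    \<comment> \<open>In \<open>ennreal\<close> a sum is finite only if both summands are, so
      finiteness of the right-hand terms follows from that of the left-hand side.\<close>
    using mutual_info_decomposition by (auto simp: ennreal_add_eq_top less_top)
qed

end
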